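(* There exists an absolute constant $C_0>0$ such that for every integer $k\ge 2$ there is a constant $\gamma_k>0$ for which the following holds. For all $C$ large enough (depending on $k$), and all $n$ large enough (depending on $k$ and $C$), if $m = C\sqrt{n}$ (a positive integer) and $\phi\sim\mathbf{P}_{\text{unif}}$ on $\mathcal{F}^k_{n,m}$, then with probability at least $1 - C_0/C^2$, $$Z(\phi) < e^{-\gamma_k C^2/C_0}\,\mathbf{E}[Z].$$
   Context: Formulas: for positive integers $n,m$ and a fixed positive integer $k$ (with $n \ge k$), $\mathcal{F}^k_{n,m}$ is the set of boolean formulas $\phi = \bigwedge_{i=1}^m C_i$ on $n$ variables $x_1,\dots,x_n$, where each clause $C_i$ is a disjunction of $k$ literals (variables or negated variables) on $k$ distinct variables. The formula is regarded as a sequence of $m$ clauses (clauses may repeat), and there are $2^k\binom{n}{k}$ possible clauses up to the order of literals; each clause is given with its $k$ literals in a uniformly random order. Under $\mathbf{P}_{\text{unif}}$, the $m$ clauses are independent and uniform among the $2^k\binom{n}{k}$ possible clauses. $Z = Z(\phi)$ is the number of assignments in $\{0,1\}^n$ that satisfy $\phi$, and $\mathbf{E}[Z]$ is its expectation under $\mathbf{P}_{\text{unif}}$. *)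

theory Defs
  imports "HOL-Probability.Probability" "HOL-Combinatorics.Multiset_Permutations"
begin

text \<open>
  The literal \<open>(i, True)\<close> is the variable \<open>x\<^sub>i\<close> and \<open>(i, False)\<close> is its negation; variables are
  numbered \<open>1, \<dots>, n\<close>.
\<close>

type_synonym literal = "nat \<times> bool"

text \<open>Clauses up to the order of their literals; \<open>inj_on fst c\<close> makes the variables distinct.\<close>

definition clauses :: "nat \<Rightarrow> nat \<Rightarrow> literal set set" where
  "clauses k n = {c. fst ` c \<subseteq> {1..n} \<and> inj_on fst c \<and> card c = k}"

lemma clauses_eq_image:
  "clauses k n =
     (\<lambda>(V, f). (\<lambda>i. (i, f i)) ` V) ` (SIGMA V:{V. V \<subseteq> {1..n} \<and> card V = k}. V \<rightarrow>\<^sub>E UNIV)"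
  (is "_ = ?g ` ?S")
proof (intro equalityI subsetI)
  fix c assume "c \<in> clauses k n"
  hence c: "fst ` c \<subseteq> {1..n}" "inj_on fst c" "card c = k"
    by (auto simp: clauses_def)
  define f where "f = restrict (\<lambda>i. snd (the_inv_into c fst i)) (fst ` c)"
  have "f (fst l) = snd l" if "l \<in> c" for l
    using that c(2) by (simp add: f_def the_inv_into_f_f)
  hence "(\<lambda>i. (i, f i)) ` fst ` c = c"
    by (simp add: image_image)
  moreover have "(fst ` c, f) \<in> ?S"
    using c by (auto simp: f_def card_image)
  ultimately show "c \<in> ?g ` ?S"
    by (intro image_eqI[of _ _ "(fst ` c, f)"]) auto
next
  fix c assume "c \<in> ?g ` ?S"
  then obtain V f where c: "c = (\<lambda>i. (i, f i)) ` V" and V: "V \<subseteq> {1..n}" "card V = k"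
    by auto
  have "finite V"
    using V by (meson finite_atLeastAtMost finite_subset)
  moreover have "inj_on (\<lambda>i. (i, f i)) V"
    by (auto simp: inj_on_def)
  ultimately show "c \<in> clauses k n"
    using V by (auto simp: clauses_def c card_image inj_on_def)
qed

lemma card_clauses: "card (clauses k n) = 2 ^ k * (n choose k)"
proof -
  let ?g = "\<lambda>(V, f). (\<lambda>i. (i, f i)) ` V"
  let ?S = "SIGMA V:{V. V \<subseteq> {1..n} \<and> card V = k}. V \<rightarrow>\<^sub>E (UNIV :: bool set)"
  have fin: "finite V" if "V \<subseteq> {1..n}" for V
    using that finite_subset by blast
  have "inj_on ?g ?S"
  proof (rule inj_onI)
    fix p q assume pq: "p \<in> ?S" "q \<in> ?S" "?g p = ?g q"
    obtain V f W h where [simp]: "p = (V, f)" "q = (W, h)"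
      by (cases p, cases q) auto
    have eq: "(\<lambda>i. (i, f i)) ` V = (\<lambda>i. (i, h i)) ` W"
      using pq(3) by simp
    hence "fst ` (\<lambda>i. (i, f i)) ` V = fst ` (\<lambda>i. (i, h i)) ` W"
      by simp
    hence VW: "V = W"
      by (simp add: image_image)
    moreover have "f = h"
    proof (rule PiE_ext[of f V "\<lambda>_. UNIV" h])
      fix i assume "i \<in> V"
      hence "(i, f i) \<in> (\<lambda>i. (i, h i)) ` W"
        using eq by blast
      thus "f i = h i" by auto
    qed (use pq VW in auto)
    ultimately show "p = q" by simp
  qed
  hence "card (clauses k n) = card ?S"
    by (simp add: clauses_eq_image card_image)
  also have "\<dots> = (\<Sum>V | V \<subseteq> {1..n} \<and> card V = k. card (V \<rightarrow>\<^sub>E (UNIV :: bool set)))"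
    by (intro card_SigmaI) (auto intro!: finite_PiE fin)
  also have "\<dots> = (\<Sum>V | V \<subseteq> {1..n} \<and> card V = k. 2 ^ k)"
    by (intro sum.cong refl) (auto simp: card_PiE fin)
  also have "\<dots> = 2 ^ k * (n choose k)"
    by (simp add: n_subsets)
  finally show ?thesis .
qed

text \<open>
  A random clause: uniform among the \<open>2 ^ k * (n choose k)\<close> possible clauses, with its literals then
  listed in uniformly random order. For \<open>n < k\<close> there are no clauses and the value is meaningless.
\<close>

definition random_clause :: "nat \<Rightarrow> nat \<Rightarrow> literal list pmf" where
  "random_clause k n = bind_pmf (pmf_of_set (clauses k n)) (\<lambda>c. pmf_of_set (permutations_of_set c))"

definition P_unif :: "nat \<Rightarrow> nat \<Rightarrow> nat \<Rightarrow> literal list list pmf" where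
  "P_unif k n m = replicate_pmf m (random_clause k n)"

definition satisfies :: "(nat \<Rightarrow> bool) \<Rightarrow> literal list list \<Rightarrow> bool" where
  "satisfies \<sigma> \<phi> \<longleftrightarrow> (\<forall>c\<in>set \<phi>. \<exists>(i, b)\<in>set c. \<sigma> i = b)"

definition Z :: "nat \<Rightarrow> literal list list \<Rightarrow> nat" where
  "Z n \<phi> = card {\<sigma> \<in> {1..n} \<rightarrow>\<^sub>E (UNIV :: bool set). satisfies \<sigma> \<phi>}"

end

theory Submission
  imports Defs
begin

text \<open>
  The clauses are exposed one at a time. A further clause multiplies the number of solutions by
  \<open>1 - 2 ^ (- k)\<close> on average, but if it contains a literal that is biased under the uniform distribution
  on the current solutions, this factor genuinely fluctuates, and the expectation of the square root
  of the number of solutions drops by more than the square root of \<open>1 - 2 ^ (- k)\<close>. Most clauses are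
  isolated, i.e. share no variable with any other clause, and an isolated clause biases each of its
  literals. Hence in the second half of the exposure there are of order \<open>m\<close> biased literals, each new
  clause contains one with probability of order \<open>m / n\<close>, and altogether the expected square root of
  \<open>Z / E[Z]\<close>, on the event that most clauses are isolated, is at most \<open>exp (- \<kappa> * m\<^sup>2 / n) = exp (- \<kappa> * C\<^sup>2)\<close>
  for a constant \<open>\<kappa>\<close> depending on \<open>k\<close>. Markov's inequality concludes.
\<close>

subsection \<open>Counting clauses\<close>

lemma finite_clauses: "finite (clauses k n)"
proof (rule finite_subset)
  show "clauses k n \<subseteq> Pow ({1..n} \<times> UNIV)"
    by (auto simp: clauses_def)
qed simp

lemma finite_clause: "c \<in> clauses k n \<Longrightarrow> finite c"
  unfolding clauses_def by (metis (mono_tags, lifting) finite_atLeastAtMost finite_imageD finite_subset mem_Collect_eq)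

lemma clauses_nonempty: "k \<le> n \<Longrightarrow> clauses k n \<noteq> {}"
  using card_clauses[of k n] by (metis card.empty mult_eq_0_iff power_eq_0_iff zero_neq_numeral binomial_eq_0_iff not_less)

lemma card_subsets_containing:
  assumes "finite A" "a \<in> A" "0 < k"
  shows "card {V. V \<subseteq> A \<and> card V = k \<and> a \<in> V} = (card A - 1) choose (k - 1)"
proof -
  have "{V. V \<subseteq> A \<and> card V = k \<and> a \<in> V} = insert a ` {W. W \<subseteq> A - {a} \<and> card W = k - 1}"
  proof (intro equalityI subsetI)
    fix V assume V: "V \<in> {V. V \<subseteq> A \<and> card V = k \<and> a \<in> V}"
    hence "V = insert a (V - {a})" "card (V - {a}) = k - 1"
      using assms finite_subset by auto
    with V show "V \<in> insert a ` {W. W \<subseteq> A - {a} \<and> card W = k - 1}"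
      by blast
  next
    fix V assume "V \<in> insert a ` {W. W \<subseteq> A - {a} \<and> card W = k - 1}"
    then obtain W where W: "V = insert a W" "W \<subseteq> A - {a}" "card W = k - 1"
      by blast
    moreover have "finite W" "a \<notin> W"
      using W assms(1) finite_subset by auto
    ultimately show "V \<in> {V. V \<subseteq> A \<and> card V = k \<and> a \<in> V}"
      using assms by auto
  qed
  moreover have "inj_on (insert a) {W. W \<subseteq> A - {a} \<and> card W = k - 1}"
    by (auto simp: inj_on_def)
  ultimately show ?thesis
    using assms by (simp add: card_image n_subsets)
qed

text \<open>A clause without repeated variables is the graph of a sign function on its set of variables.\<close>

lemma inj_on_sign_graph: "inj_on (\<lambda>(V, f). (\<lambda>i. (i, f i)) ` V) (SIGMA V:X. V \<rightarrow>\<^sub>E (UNIV :: bool set))"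
proof (rule inj_onI)
  fix p q assume pq: "p \<in> (SIGMA V:X. V \<rightarrow>\<^sub>E (UNIV :: bool set))"
    "q \<in> (SIGMA V:X. V \<rightarrow>\<^sub>E (UNIV :: bool set))"
    "(\<lambda>(V, f). (\<lambda>i. (i, f i)) ` V) p = (\<lambda>(V, f). (\<lambda>i. (i, f i)) ` V) q"
  obtain V f W h where [simp]: "p = (V, f)" "q = (W, h)"
    by (cases p, cases q) auto
  have eq: "(\<lambda>i. (i, f i)) ` V = (\<lambda>i. (i, h i)) ` W"
    using pq(3) by simp
  hence "fst ` (\<lambda>i. (i, f i)) ` V = fst ` (\<lambda>i. (i, h i)) ` W"
    by simp
  hence VW: "V = W"
    by (simp add: image_image)
  moreover have "f i = h i" if "i \<in> V" for i
    using that eq by (auto dest: equalityD1[THEN subsetD])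
  ultimately show "p = q"
    using pq by (auto intro!: PiE_ext[of f V "\<lambda>_. UNIV" h])
qed

text \<open>The variable set must contain \<open>i\<close> and the sign at \<open>i\<close> is
  forced, so only \<open>k - 1\<close> variables and \<open>k - 1\<close> signs remain free.\<close>

lemma card_clauses_containing_literal:
  assumes "fst l \<in> {1..n}" "0 < k"
  shows "card {c \<in> clauses k n. l \<in> c} = 2 ^ (k - 1) * ((n - 1) choose (k - 1))"
proof -
  obtain i b where l: "l = (i, b)" by (cases l)
  have i: "i \<in> {1..n}" using assms by (simp add: l)
  let ?g = "\<lambda>(V, f). (\<lambda>i. (i, f i)) ` V"
  let ?X = "{V. V \<subseteq> {1..n} \<and> card V = k}"
  let ?Y = "{V. V \<subseteq> {1..n} \<and> card V = k \<and> i \<in> V}"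
  let ?B = "\<lambda>V. \<Pi>\<^sub>E j\<in>V. if j = i then {b} else (UNIV :: bool set)"
  have fin: "finite V" if "V \<in> ?Y" for V
    using that finite_subset by auto
  have finY: "finite ?Y" by (rule finite_subset[of _ "Pow {1..n}"]) auto
  have "{c \<in> clauses k n. l \<in> c} = ?g ` Sigma ?Y ?B"
  proof (intro equalityI subsetI)
    fix c assume "c \<in> {c \<in> clauses k n. l \<in> c}"
    then obtain V f where "c = ?g (V, f)" "V \<in> ?X" "f \<in> V \<rightarrow>\<^sub>E UNIV" "l \<in> c"
      unfolding clauses_eq_image by blast
    moreover from this have "i \<in> V" "f i = b" by (auto simp: l)
    ultimately have "(V, f) \<in> Sigma ?Y ?B"
      by (auto simp: PiE_iff extensional_def)
    thus "c \<in> ?g ` Sigma ?Y ?B" using \<open>c = _\<close> by blast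
  next
    fix c assume "c \<in> ?g ` Sigma ?Y ?B"
    then obtain V f where Vf: "c = ?g (V, f)" "V \<in> ?Y" "f \<in> ?B V" by blast
    hence fi: "f i = b" "i \<in> V" by (auto simp: PiE_iff split: if_splits)
    have "(V, f) \<in> (SIGMA V:?X. V \<rightarrow>\<^sub>E UNIV)"
      using Vf by (auto simp: PiE_iff)
    hence "c \<in> clauses k n"
      unfolding clauses_eq_image using Vf(1) by blast
    moreover have "l \<in> c" using fi Vf(1) by (auto simp: l)
    ultimately show "c \<in> {c \<in> clauses k n. l \<in> c}" by blast
  qed
  moreover have "inj_on ?g (Sigma ?Y ?B)"
    by (rule inj_on_subset[OF inj_on_sign_graph[of ?Y]]) (auto simp: PiE_iff)
  ultimately have "card {c \<in> clauses k n. l \<in> c} = card (Sigma ?Y ?B)"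
    by (simp add: card_image)
  also have "\<dots> = (\<Sum>V\<in>?Y. card (?B V))"
    by (intro card_SigmaI finY ballI finite_PiE fin) auto
  also have "\<dots> = (\<Sum>V\<in>?Y. 2 ^ (k - 1))"
  proof (intro sum.cong refl)
    fix V assume V: "V \<in> ?Y"
    hence "card (?B V) = (\<Prod>j\<in>V. card (if j = i then {b} else (UNIV :: bool set)))"
      by (intro card_PiE fin)
    also have "\<dots> = (\<Prod>j\<in>V - {i}. 2)"
      using V fin[OF V] by (subst prod.remove[of V i]) auto
    also have "\<dots> = 2 ^ (k - 1)"
      using V fin[OF V] by simp
    finally show "card (?B V) = 2 ^ (k - 1)" .
  qed
  also have "\<dots> = 2 ^ (k - 1) * ((n - 1) choose (k - 1))"
    using card_subsets_containing[of "{1..n}" i k] i assms by simp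
  finally show ?thesis .
qed

section \<open>Clauses violated by a fixed assignment\<close>

definition violates :: "(nat \<Rightarrow> bool) \<Rightarrow> literal set \<Rightarrow> bool" where
  "violates \<sigma> c \<longleftrightarrow> (\<forall>(i, b)\<in>c. \<sigma> i \<noteq> b)"

text \<open>Each set of variables carries exactly one clause violated by \<sigma>, the one whose
  literals are all false under \<sigma>. The predicate \<open>Q\<close> later serves to require that
  a given variable occurs.\<close>

lemma violated_clauses_eq_image:
  "{c \<in> clauses k n. violates \<sigma> c \<and> Q (fst ` c)} =
     (\<lambda>V. (\<lambda>i. (i, \<not> \<sigma> i)) ` V) ` {V. V \<subseteq> {1..n} \<and> card V = k \<and> Q V}" (is "?L = ?R")
proof (intro equalityI subsetI)
  fix c assume c: "c \<in> ?L"
  hence "c = (\<lambda>i. (i, \<not> \<sigma> i)) ` fst ` c"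
    by (force simp: violates_def image_image)
  moreover have "card (fst ` c) = k"
    using c by (simp add: clauses_def card_image)
  ultimately show "c \<in> ?R"
    using c by (auto simp: clauses_def)
next
  fix c assume "c \<in> ?R"
  then obtain V where V: "c = (\<lambda>i. (i, \<not> \<sigma> i)) ` V" "V \<subseteq> {1..n}" "card V = k" "Q V"
    by blast
  have "fst ` c = V" by (simp add: V image_image)
  moreover have "card c = k" using V by (simp add: card_image inj_on_def)
  ultimately show "c \<in> ?L"
    using V by (auto simp: clauses_def violates_def inj_on_def)
qed

lemma card_violated_clauses_vars:
  "card {c \<in> clauses k n. violates \<sigma> c \<and> Q (fst ` c)} = card {V. V \<subseteq> {1..n} \<and> card V = k \<and> Q V}"
proof -
  have "inj_on (\<lambda>V. (\<lambda>i. (i, \<not> \<sigma> i)) ` V) X" for X :: "nat set set"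
  proof (rule inj_onI)
    fix V W :: "nat set" assume "(\<lambda>i. (i, \<not> \<sigma> i)) ` V = (\<lambda>i. (i, \<not> \<sigma> i)) ` W"
    hence "fst ` (\<lambda>i. (i, \<not> \<sigma> i)) ` V = fst ` (\<lambda>i. (i, \<not> \<sigma> i)) ` W" by simp
    thus "V = W" by (simp add: image_image)
  qed
  thus ?thesis
    by (simp add: violated_clauses_eq_image card_image)
qed

lemma card_violated_clauses: "card {c \<in> clauses k n. violates \<sigma> c} = n choose k"
  using card_violated_clauses_vars[of k n \<sigma> "\<lambda>_. True"] by (simp add: n_subsets)

text \<open>If \<sigma> makes \<open>l\<close> false, a violated clause contains \<open>l\<close> as
  soon as it contains the variable of \<open>l\<close>; if \<sigma> makes \<open>l\<close> true, no
  violated clause contains it.\<close>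

lemma card_violated_clauses_containing_literal:
  assumes "fst l \<in> {1..n}" "0 < k"
  shows "card {c \<in> clauses k n. violates \<sigma> c \<and> l \<in> c} =
    (if \<sigma> (fst l) \<noteq> snd l then (n - 1) choose (k - 1) else 0)"
proof (cases "\<sigma> (fst l) = snd l")
  case True
  hence "\<not> (violates \<sigma> c \<and> l \<in> c)" for c
    by (cases l) (auto simp: violates_def)
  hence "{c \<in> clauses k n. violates \<sigma> c \<and> l \<in> c} = {}"
    by blast
  with True show ?thesis by (simp only: card.empty) simp
next
  case False
  hence "l \<in> c \<longleftrightarrow> fst l \<in> fst ` c" if "violates \<sigma> c" for c
    using that by (cases l) (force simp: violates_def)
  hence "{c \<in> clauses k n. violates \<sigma> c \<and> l \<in> c} = {c \<in> clauses k n. violates \<sigma> c \<and> fst l \<in> fst ` c}"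
    by blast
  also have "card \<dots> = (n - 1) choose (k - 1)"
    using card_violated_clauses_vars[of k n \<sigma> "\<lambda>V. fst l \<in> V"] 
      card_subsets_containing[of "{1..n}" "fst l" k] assms by simp
  finally show ?thesis using False by simp
qed

subsection \<open>Averages over a random clause\<close>

text \<open>Satisfaction and shared variables depend only on the set of literals, so this reduces
  expectations over ordered clauses to counting.\<close>

lemma map_set_random_clause:
  assumes "k \<le> n"
  shows "map_pmf set (random_clause k n) = pmf_of_set (clauses k n)"
proof -
  have "map_pmf set (random_clause k n) =
      bind_pmf (pmf_of_set (clauses k n)) (\<lambda>c. map_pmf set (pmf_of_set (permutations_of_set c)))"
    by (simp add: random_clause_def map_bind_pmf)
  also have "\<dots> = bind_pmf (pmf_of_set (clauses k n)) return_pmf"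
  proof (rule bind_pmf_cong[OF refl])
    fix c assume "c \<in> set_pmf (pmf_of_set (clauses k n))"
    hence "c \<in> clauses k n"
      using finite_clauses clauses_nonempty[OF assms] by auto
    hence c: "finite c" by (rule finite_clause)
    have "map_pmf set (pmf_of_set (permutations_of_set c)) =
        map_pmf (\<lambda>_. c) (pmf_of_set (permutations_of_set c))"
      using c by (intro map_pmf_cong) (auto dest: permutations_of_setD)
    thus "map_pmf set (pmf_of_set (permutations_of_set c)) = return_pmf c"
      by (simp add: map_pmf_const)
  qed
  finally show ?thesis by (simp add: bind_return_pmf')
qed

lemma set_random_clause:
  assumes "k \<le> n" "xs \<in> set_pmf (random_clause k n)"
  shows "set xs \<in> clauses k n"
proof -
  have "set xs \<in> set_pmf (map_pmf set (random_clause k n))"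
    using assms(2) by simp
  thus ?thesis
    using assms(1) finite_clauses clauses_nonempty by (simp add: map_set_random_clause)
qed

lemma finite_set_random_clause:
  assumes "k \<le> n"
  shows "finite (set_pmf (random_clause k n))"
  unfolding random_clause_def
  using finite_clauses[of k n] clauses_nonempty[OF assms] finite_clause[of _ k n] by auto

lemma expectation_random_clause:
  fixes F :: "literal set \<Rightarrow> real"
  assumes "k \<le> n"
  shows "measure_pmf.expectation (random_clause k n) (\<lambda>xs. F (set xs)) =
    (\<Sum>c\<in>clauses k n. F c) / card (clauses k n)"
proof -
  have "measure_pmf.expectation (random_clause k n) (\<lambda>xs. F (set xs)) =
      measure_pmf.expectation (map_pmf set (random_clause k n)) F"
    by simp
  also have "\<dots> = (\<Sum>c\<in>clauses k n. F c) / card (clauses k n)"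
    using finite_clauses clauses_nonempty[OF assms]
    by (simp add: map_set_random_clause[OF assms] integral_pmf_of_set)
  finally show ?thesis .
qed

lemma prob_random_clause:
  assumes "k \<le> n"
  shows "measure_pmf.expectation (random_clause k n) (\<lambda>xs. of_bool (Q (set xs)) :: real) =
    real (card {c \<in> clauses k n. Q c}) / (2 ^ k * real (n choose k))"
  using assms finite_clauses[of k n]
  by (subst expectation_random_clause) (simp_all add: card_clauses sum.If_cases Int_def of_bool_def)

text \<open>Absorption identity for binomial coefficients. The ratio is the probability that a given
  variable occurs in a random clause.\<close>

lemma literal_count_ratio:
  assumes "0 < k" "k \<le> n"
  shows "real ((n - 1) choose (k - 1)) / real (n choose k) = real k / real n"
proof -
  have "real k * real (n choose k) = real n * real ((n - 1) choose (k - 1))"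
    by (metis assms(1) of_nat_mult times_binomial_minus1_eq)
  thus ?thesis
    using assms by (simp add: field_simps)
qed

lemma prob_violates:
  assumes "k \<le> n"
  shows "measure_pmf.expectation (random_clause k n) (\<lambda>xs. of_bool (violates \<sigma> (set xs)) :: real) = 1 / 2 ^ k"
  using assms by (subst prob_random_clause) (simp_all add: card_violated_clauses)

lemma prob_contains_literal:
  assumes "0 < k" "k \<le> n" "fst l \<in> {1..n}"
  shows "measure_pmf.expectation (random_clause k n) (\<lambda>xs. of_bool (l \<in> set xs) :: real) = real k / (2 * real n)"
proof -
  have "(2::real) ^ k = 2 * 2 ^ (k - 1)"
    using assms(1) by (metis power_minus_mult mult.commute)
  thus ?thesis
    using assms literal_count_ratio[of k n]
    by (subst prob_random_clause) (simp_all add: card_clauses_containing_literal field_simps)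
qed

text \<open>The variable of \<open>l\<close> occurs with probability \<open>k / n\<close>. Then
  exactly one of the \<open>2 ^ k\<close> sign patterns is violated by \<sigma>, and it contains
  \<open>l\<close> only if \<sigma> makes \<open>l\<close> false.\<close>

lemma prob_contains_literal_violates:
  assumes "0 < k" "k \<le> n" "fst l \<in> {1..n}"
  shows "measure_pmf.expectation (random_clause k n) (\<lambda>xs. of_bool (violates \<sigma> (set xs) \<and> l \<in> set xs) :: real) =
    of_bool (\<sigma> (fst l) \<noteq> snd l) * real k / (2 ^ k * real n)"
  using assms literal_count_ratio[of k n]
  by (subst prob_random_clause) (simp_all add: card_violated_clauses_containing_literal field_simps)

subsection \<open>Isolated clauses\<close>

definition solutions :: "nat \<Rightarrow> literal list list \<Rightarrow> (nat \<Rightarrow> bool) set" where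
  "solutions n \<phi> = {\<sigma> \<in> {1..n} \<rightarrow>\<^sub>E (UNIV :: bool set). satisfies \<sigma> \<phi>}"

lemma Z_eq: "Z n \<phi> = card (solutions n \<phi>)"
  by (simp add: Z_def solutions_def)

lemma finite_solutions [simp]: "finite (solutions n \<phi>)"
proof (rule finite_subset)
  show "solutions n \<phi> \<subseteq> {1..n} \<rightarrow>\<^sub>E UNIV"
    unfolding solutions_def by blast
qed (simp add: finite_PiE)

lemma satisfies_Cons: "satisfies \<sigma> (c # \<phi>) \<longleftrightarrow> satisfies \<sigma> \<phi> \<and> \<not> violates \<sigma> (set c)"
  by (auto simp: satisfies_def violates_def)

text \<open>Linear in the violation indicators, so that the expectation over \<open>c\<close> can be
  taken solution by solution.\<close>

lemma Z_Cons:
  "real (Z n (c # \<phi>)) = real (Z n \<phi>) - (\<Sum>\<sigma>\<in>solutions n \<phi>. of_bool (violates \<sigma> (set c)))"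
proof -
  have "solutions n (c # \<phi>) = {\<sigma> \<in> solutions n \<phi>. \<not> violates \<sigma> (set c)}"
    by (auto simp: solutions_def satisfies_Cons)
  hence "real (Z n (c # \<phi>)) = (\<Sum>\<sigma>\<in>solutions n \<phi>. of_bool (\<not> violates \<sigma> (set c)))"
    by (simp add: Z_eq of_bool_def sum.If_cases Int_def)
  also have "\<dots> = (\<Sum>\<sigma>\<in>solutions n \<phi>. 1 - of_bool (violates \<sigma> (set c)))"
    by (intro sum.cong) auto
  finally show ?thesis
    by (simp add: sum_subtractf Z_eq)
qed

lemma Z_Cons_le: "Z n (c # \<phi>) \<le> Z n \<phi>"
  unfolding Z_eq by (rule card_mono[OF finite_solutions]) (auto simp: solutions_def satisfies_Cons)

definition meets :: "literal list \<Rightarrow> literal list \<Rightarrow> bool" where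
  "meets c d \<longleftrightarrow> fst ` set c \<inter> fst ` set d \<noteq> {}"

lemma meets_sym: "meets c d \<longleftrightarrow> meets d c"
  by (auto simp: meets_def)

lemma meets_self: "c \<noteq> [] \<Longrightarrow> meets c c"
  by (auto simp: meets_def)

text \<open>Counts pairs of positions rather than of distinct clauses, so a repeated nonempty clause
  contributes as well.\<close>

fun overlaps :: "literal list list \<Rightarrow> nat" where
  "overlaps [] = 0"
| "overlaps (c # \<phi>) = overlaps \<phi> + length (filter (meets c) \<phi>)"

text \<open>Only clauses different from \<open>c\<close> are compared with it: a second copy of
  \<open>c\<close> imposes the same constraint and does not disturb the bias of its
  literals.\<close>

definition isolated :: "literal list list \<Rightarrow> literal list set" where
  "isolated \<phi> = {c \<in> set \<phi>. \<forall>d\<in>set \<phi>. d \<noteq> c \<longrightarrow> \<not> meets c d}"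

lemma finite_isolated [simp]: "finite (isolated \<phi>)"
  by (simp add: isolated_def)

text \<open>A new clause meeting no earlier one is itself isolated. One that meets
  \<open>r \<ge> 1\<close> earlier clauses spoils at most \<open>r\<close> isolated ones and need
  not be isolated, a loss of at most \<open>1 + r \<le> 2 * r\<close>.\<close>

lemma length_le_card_isolated:
  "[] \<notin> set \<phi> \<Longrightarrow> length \<phi> \<le> card (isolated \<phi>) + 2 * overlaps \<phi>"
proof (induction \<phi>)
  case (Cons c \<phi>)
  show ?case
  proof (cases "filter (meets c) \<phi> = []")
    case True
    hence none: "\<not> meets c d" if "d \<in> set \<phi>" for d
      using that by (auto simp: filter_empty_conv)
    hence "c \<notin> set \<phi>"
      using meets_self[of c] Cons.prems by auto
    moreover have "isolated (c # \<phi>) = insert c (isolated \<phi>)"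
      using none \<open>c \<notin> set \<phi>\<close> by (auto simp: isolated_def meets_sym[of _ c])
    ultimately have "card (isolated (c # \<phi>)) = Suc (card (isolated \<phi>))"
      by (simp add: isolated_def)
    with True Cons show ?thesis by simp
  next
    case False
    let ?F = "filter (meets c) \<phi>"
    have "isolated \<phi> - set ?F \<subseteq> isolated (c # \<phi>)"
      by (auto simp: isolated_def meets_sym[of _ c])
    hence "card (isolated \<phi> - set ?F) \<le> card (isolated (c # \<phi>))"
      by (intro card_mono) auto
    moreover have "card (isolated \<phi>) - card (set ?F) \<le> card (isolated \<phi> - set ?F)"
      by (rule diff_card_le_card_Diff) simp
    moreover have "card (set ?F) \<le> length ?F"
      by (rule card_length)
    moreover have "length ?F \<ge> 1"
      using False by (cases ?F) auto
    ultimately show ?thesis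
      using Cons by simp
  qed
qed simp

text \<open>
  Switching the variable of \<open>l\<close> to satisfy \<open>l\<close> injects the solutions falsifying \<open>l\<close> into those
  satisfying it. It misses the solutions in which \<open>l\<close> is the only true literal of \<open>c\<close>, and every
  solution becomes one of these by resetting the \<open>k\<close> variables of \<open>c\<close>.
\<close>

lemma isolated_literal_bias:
  assumes c: "c \<in> isolated \<phi>" "set c \<in> clauses k n" and l: "l \<in> set c"
  shows "2 * real (card {\<sigma> \<in> solutions n \<phi>. \<sigma> (fst l) \<noteq> snd l}) \<le> real (Z n \<phi>) * (1 - 1 / 2 ^ k)"
proof -
  obtain i b where ib: "l = (i, b)" by (cases l)
  let ?V = "fst ` set c"
  have V: "?V \<subseteq> {1..n}" "card ?V = k" and inj: "inj_on fst (set c)"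
    using c(2) by (auto simp: clauses_def card_image)
  have uniq: "s = t" if "(j, s) \<in> set c" "(j, t) \<in> set c" for j s t
    using inj_onD[OF inj, of "(j, s)" "(j, t)"] that by simp
  have cphi: "c \<in> set \<phi>" using c(1) by (simp add: isolated_def)
  \<comment> \<open>Changing an assignment on the variables of \<open>c\<close> therefore leaves the
    truth value of every other clause unchanged.\<close>
  have disj: "j \<notin> ?V" if "d \<in> set \<phi>" "d \<noteq> c" "(j, s) \<in> set d" for d j s
  proof -
    have "fst ` set c \<inter> fst ` set d = {}"
      using c(1) that by (auto simp: isolated_def meets_def)
    moreover have "j \<in> fst ` set d" using that(3) by force
    ultimately show ?thesis by blast
  qed
  define S where "S = solutions n \<phi>"
  define T where "T = {\<sigma> \<in> S. \<sigma> i = b}"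
  define F where "F = {\<sigma> \<in> S. \<sigma> i \<noteq> b}"
  define U where "U = {\<sigma> \<in> T. \<forall>(j, s)\<in>set c. j \<noteq> i \<longrightarrow> \<sigma> j \<noteq> s}"
  have fin: "finite S" "finite T" "finite F" "finite U"
    by (auto simp: S_def T_def F_def U_def)
  have iV: "i \<in> ?V" using l ib by force
  have ST: "card S = card T + card F"
  proof -
    have "T \<union> F = S" unfolding T_def F_def by blast
    moreover have "T \<inter> F = {}" unfolding T_def F_def by blast
    ultimately show ?thesis using card_Un_disjoint[OF fin(2,3)] by simp
  qed
  let ?f = "\<lambda>\<sigma>::nat \<Rightarrow> bool. \<sigma>(i := b)"
  have "?f ` F \<subseteq> T - U"
  proof safe
    fix \<sigma> assume \<sigma>: "\<sigma> \<in> F"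
    have ne: "\<sigma> i \<noteq> b" and sat: "satisfies \<sigma> \<phi>" and ext: "\<sigma> \<in> {1..n} \<rightarrow>\<^sub>E UNIV"
      using \<sigma> by (auto simp: F_def S_def solutions_def)
    have "\<exists>(j, s)\<in>set d. ?f \<sigma> j = s" if "d \<in> set \<phi>" for d
    proof (cases "d = c")
      case True
      thus ?thesis using l ib by (intro bexI[of _ "(i, b)"]) simp_all
    next
      case False
      have "\<exists>(j, s)\<in>set d. \<sigma> j = s"
        using sat that by (simp add: satisfies_def)
      then obtain j s where js: "(j, s) \<in> set d" "\<sigma> j = s"
        by blast
      have "j \<noteq> i" using disj[OF that False js(1)] iV by auto
      thus ?thesis using js by (intro bexI[of _ "(j, s)"]) simp_all
    qed
    thus "?f \<sigma> \<in> T"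
      using ext iV V(1) by (auto simp: T_def S_def solutions_def satisfies_def PiE_iff extensional_def)
    have "\<exists>(j, s)\<in>set c. \<sigma> j = s"
      using sat cphi by (simp add: satisfies_def)
    then obtain j s where js: "(j, s) \<in> set c" "\<sigma> j = s"
      by blast
    \<comment> \<open>As \<open>l\<close> is false under \<sigma>, the true literal of
      \<open>c\<close> is a different one. It stays true after the switch, so the image lies outside
      \<open>U\<close>.\<close>
    have "j \<noteq> i" using js ne uniq[of i s b] l ib by auto
    moreover assume "?f \<sigma> \<in> U"
    ultimately show False using js by (auto simp: U_def)
  qed
  moreover have "inj_on ?f F"
  proof (rule inj_onI)
    fix \<sigma> \<tau> assume st: "\<sigma> \<in> F" "\<tau> \<in> F" "?f \<sigma> = ?f \<tau>"
    show "\<sigma> = \<tau>"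
    proof
      fix j
      have "?f \<sigma> j = ?f \<tau> j" by (simp only: st(3))
      thus "\<sigma> j = \<tau> j"
        using st(1,2) by (cases "j = i") (simp_all add: F_def)
    qed
  qed
  ultimately have "card F \<le> card (T - U)"
    using fin by (metis card_image card_mono finite_Diff)
  hence FT: "card F + card U \<le> card T"
    using fin card_mono[of T U] by (simp add: card_Diff_subset U_def)
  \<comment> \<open>On the variables of \<open>c\<close>, \<rho> makes \<open>l\<close> true and
    every other literal false: a negated variable is set to true, a plain one to false.\<close>
  define \<rho> where "\<rho> j = (if j = i then b else (j, False) \<in> set c)" for j
  define g where "g \<sigma> = (\<lambda>j. if j \<in> ?V then \<rho> j else \<sigma> j)" for \<sigma> :: "nat \<Rightarrow> bool"
  \<comment> \<open>Recording the old values on \<open>?V\<close> makes the reset injective, so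
    \<open>U\<close> is at least a \<open>2 ^ k\<close>-th part of \<open>S\<close>.\<close>
  have "(\<lambda>\<sigma>. (g \<sigma>, restrict \<sigma> ?V)) ` S \<subseteq> U \<times> (?V \<rightarrow>\<^sub>E UNIV)"
  proof safe
    fix \<sigma> assume \<sigma>: "\<sigma> \<in> S"
    have sat: "satisfies \<sigma> \<phi>" and ext: "\<sigma> \<in> {1..n} \<rightarrow>\<^sub>E UNIV"
      using \<sigma> by (auto simp: S_def solutions_def)
    have "\<exists>(j, s)\<in>set d. g \<sigma> j = s" if "d \<in> set \<phi>" for d
    proof (cases "d = c")
      case True
      thus ?thesis using l ib iV by (intro bexI[of _ "(i, b)"]) (simp_all add: g_def \<rho>_def)
    next
      case False
      have "\<exists>(j, s)\<in>set d. \<sigma> j = s"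
        using sat that by (simp add: satisfies_def)
      then obtain j s where js: "(j, s) \<in> set d" "\<sigma> j = s"
        by blast
      have "j \<notin> ?V" by (rule disj[OF that False js(1)])
      thus ?thesis using js by (intro bexI[of _ "(j, s)"]) (simp_all add: g_def)
    qed
    moreover have "g \<sigma> \<in> {1..n} \<rightarrow>\<^sub>E UNIV"
      using ext V(1) by (auto simp: g_def PiE_iff extensional_def)
    moreover have "g \<sigma> j \<noteq> s" if "(j, s) \<in> set c" "j \<noteq> i" for j s
    proof -
      have "j \<in> ?V" using that(1) by force
      thus ?thesis
        using that uniq[of j False s] by (cases s) (auto simp: g_def \<rho>_def)
    qed
    moreover have "g \<sigma> i = b" using iV by (simp add: g_def \<rho>_def)
    ultimately show "g \<sigma> \<in> U"
      by (auto simp: U_def T_def S_def solutions_def satisfies_def)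
  qed auto
  moreover have "inj_on (\<lambda>\<sigma>. (g \<sigma>, restrict \<sigma> ?V)) S"
  proof (rule inj_onI)
    fix \<sigma> \<tau> assume st: "(g \<sigma>, restrict \<sigma> ?V) = (g \<tau>, restrict \<tau> ?V)"
    show "\<sigma> = \<tau>"
    proof
      fix j
      have "g \<sigma> = g \<tau>" "restrict \<sigma> ?V = restrict \<tau> ?V"
        using st by (simp_all only: prod.inject)
      hence "g \<sigma> j = g \<tau> j" "restrict \<sigma> ?V j = restrict \<tau> ?V j"
        by (simp_all only:)
      thus "\<sigma> j = \<tau> j" by (cases "j \<in> ?V") (auto simp: g_def)
    qed
  qed
  moreover have "finite (U \<times> (?V \<rightarrow>\<^sub>E (UNIV :: bool set)))"
    using fin by (simp add: finite_PiE)
  ultimately have "card S \<le> card (U \<times> (?V \<rightarrow>\<^sub>E (UNIV :: bool set)))"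
    by (intro card_inj_on_le)
  also have "\<dots> = card U * 2 ^ k"
    using V(2) by (simp add: card_cartesian_product card_PiE)
  finally have "real (card S) \<le> real (card U * 2 ^ k)"
    by (rule of_nat_mono)
  hence "real (card S) / 2 ^ k \<le> real (card U)"
    by (simp add: field_simps)
  moreover have "2 * real (card F) + real (card U) \<le> real (card S)"
    using FT ST by linarith
  ultimately show ?thesis
    by (simp add: Z_eq F_def S_def ib algebra_simps)
qed

subsection \<open>Adding one clause\<close>

lemma integrable_random_clause:
  fixes f :: "literal list \<Rightarrow> real"
  assumes "k \<le> n"
  shows "integrable (measure_pmf (random_clause k n)) f"
  by (rule integrable_measure_pmf_finite[OF finite_set_random_clause[OF assms]])

lemma expectation_Z_Cons:
  assumes "k \<le> n"
  shows "measure_pmf.expectation (random_clause k n) (\<lambda>c. real (Z n (c # \<phi>))) =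
    (1 - 1 / 2 ^ k) * real (Z n \<phi>)"
proof -
  note int = integrable_random_clause[OF assms]
  have "measure_pmf.expectation (random_clause k n) (\<lambda>c. real (Z n (c # \<phi>))) =
      real (Z n \<phi>) - real (card (solutions n \<phi>)) / 2 ^ k"
    using int by (simp add: Z_Cons prob_violates[OF assms] del: sum_of_bool_eq)
  thus ?thesis
    by (simp add: Z_eq algebra_simps)
qed

text \<open>The clause contains \<open>l\<close> with probability \<open>k / (2 * n)\<close>. Given
  that, a solution making \<open>l\<close> true always survives, and one making \<open>l\<close>
  false is lost with probability \<open>2 / 2 ^ k\<close>, since only the other signs are still
  random.\<close>

lemma expectation_Z_Cons_literal:
  assumes "0 < k" "k \<le> n" "fst l \<in> {1..n}"
  shows "measure_pmf.expectation (random_clause k n) (\<lambda>c. of_bool (l \<in> set c) * real (Z n (c # \<phi>))) =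
    real k / (2 * real n) * 
      (real (Z n \<phi>) - 2 * real (card {\<sigma> \<in> solutions n \<phi>. \<sigma> (fst l) \<noteq> snd l}) / 2 ^ k)"
proof -
  note int = integrable_random_clause[OF assms(2)]
  have "of_bool (l \<in> set c) * real (Z n (c # \<phi>)) = of_bool (l \<in> set c) * real (Z n \<phi>) -
      (\<Sum>\<sigma>\<in>solutions n \<phi>. of_bool (violates \<sigma> (set c) \<and> l \<in> set c))" for c
    by (simp add: Z_Cons algebra_simps)
  hence "measure_pmf.expectation (random_clause k n) (\<lambda>c. of_bool (l \<in> set c) * real (Z n (c # \<phi>))) =
      real k / (2 * real n) * real (Z n \<phi>) -
      (\<Sum>\<sigma>\<in>solutions n \<phi>. of_bool (\<sigma> (fst l) \<noteq> snd l) * real k / (2 ^ k * real n))"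
    using int by (simp add: prob_contains_literal[OF assms] prob_contains_literal_violates[OF assms]
        del: of_bool_conj sum_of_bool_eq)
  also have "(\<Sum>\<sigma>\<in>solutions n \<phi>. of_bool (\<sigma> (fst l) \<noteq> snd l) * real k / (2 ^ k * real n)) =
      real (card {\<sigma> \<in> solutions n \<phi>. \<sigma> (fst l) \<noteq> snd l}) * (real k / (2 ^ k * real n))"
  proof -
    have "(\<Sum>\<sigma>\<in>solutions n \<phi>. of_bool (\<sigma> (fst l) \<noteq> snd l) * real k / (2 ^ k * real n)) =
      (\<Sum>\<sigma>\<in>solutions n \<phi>. of_bool (\<sigma> (fst l) \<noteq> snd l)) * (real k / (2 ^ k * real n))"
      by (simp only: sum_distrib_right times_divide_eq_right sum_divide_distrib)
    also have "(\<Sum>\<sigma>\<in>solutions n \<phi>. of_bool (\<sigma> (fst l) \<noteq> snd l) :: real) =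
        real (card {\<sigma> \<in> solutions n \<phi>. \<sigma> (fst l) \<noteq> snd l})"
      by (simp add: of_bool_def sum.If_cases Int_def)
    finally show ?thesis .
  qed
  finally show ?thesis
    using assms by (simp add: field_simps)
qed

text \<open>AM-GM applied to \<open>z / y\<close> and \<open>a * y\<close> with \<open>y = 1 + \<theta> * h\<close>, and \<open>1 / y \<le> 1 - \<theta> * h + (\<theta> * h)\<^sup>2\<close>.\<close>

lemma sqrt_tilted_bound:
  fixes z Z0 a h \<theta> K :: real
  assumes "0 \<le> z" "z \<le> Z0" "0 \<le> a" "0 \<le> h" "h \<le> K" "0 \<le> \<theta>"
  shows "sqrt z * sqrt a \<le> (a + \<theta> * a * h + z - \<theta> * (h * z) + \<theta>\<^sup>2 * K * Z0 * h) / 2"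
proof -
  define u where "u = \<theta> * h"
  have u: "0 \<le> u" using assms by (simp add: u_def)
  have "sqrt z * sqrt a = sqrt ((z / (1 + u)) * (a * (1 + u)))"
    using u by (simp add: real_sqrt_mult[symmetric])
  also have "\<dots> \<le> (z / (1 + u) + a * (1 + u)) / 2"
    using assms u by (intro arith_geo_mean_sqrt) auto
  also have "z / (1 + u) \<le> z * (1 - u + u\<^sup>2)"
  proof -
    have "(1 + u) * (1 - u + u\<^sup>2) = 1 + u ^ 3"
      by (simp add: algebra_simps power2_eq_square power3_eq_cube)
    hence "1 / (1 + u) \<le> 1 - u + u\<^sup>2"
      using u by (simp add: divide_le_eq mult.commute)
    from mult_left_mono[OF this assms(1)] show ?thesis by simp
  qed
  also have "z * (1 - u + u\<^sup>2) \<le> z - \<theta> * (h * z) + \<theta>\<^sup>2 * K * Z0 * h"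
  proof -
    \<comment> \<open>Bounding one factor \<open>h\<close> by \<open>K\<close> and \<open>z\<close>
      by \<open>Z0\<close> makes the quadratic term linear in \<open>h\<close>, so that only the
      mean of \<open>h\<close> is needed.\<close>
    have "z * (h * h) \<le> Z0 * (K * h)"
      using assms by (intro mult_mono) auto
    from mult_left_mono[OF this, of "\<theta>\<^sup>2"] show ?thesis
      by (simp add: u_def algebra_simps power2_eq_square)
  qed
  finally show ?thesis
    by (simp add: u_def algebra_simps)
qed

lemma card_literals_le:
  assumes "c \<in> clauses k n" "finite L"
  shows "(\<Sum>l\<in>L. of_bool (l \<in> c)) \<le> real k"
proof -
  have "(\<Sum>l\<in>L. of_bool (l \<in> c)) = real (card (L \<inter> c))"
    using assms(2) by (simp add: of_bool_def sum.If_cases Int_def)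
  also have "card (L \<inter> c) \<le> card c"
    using finite_clause[OF assms(1)] by (intro card_mono) auto
  also have "card c = k" using assms(1) by (simp add: clauses_def)
  finally show ?thesis by simp
qed

text \<open>The number \<open>?h\<close> of literals of \<open>L\<close> in the new clause is
  positively correlated with the new number of solutions, because the solutions favour these
  literals. Through \<open>sqrt_tilted_bound\<close> this correlation becomes a loss beyond the one
  given by concavity of the square root.\<close>

lemma expectation_sqrt_Z_Cons_le:
  assumes "0 < k" "k \<le> n" and L: "finite L" "\<And>l. l \<in> L \<Longrightarrow> fst l \<in> {1..n}"
    and bias: "\<And>l. l \<in> L \<Longrightarrow>
      2 * real (card {\<sigma> \<in> solutions n \<phi>. \<sigma> (fst l) \<noteq> snd l}) \<le> real (Z n \<phi>) * (1 - 1 / 2 ^ k)"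
  shows "measure_pmf.expectation (random_clause k n) (\<lambda>c. sqrt (real (Z n (c # \<phi>)))) \<le>
    sqrt ((1 - 1 / 2 ^ k) * real (Z n \<phi>)) * (1 - card L / (16 * 16 ^ k * real n))"
proof (cases "Z n \<phi> = 0")
  case True
  hence "Z n (c # \<phi>) = 0" for c using Z_Cons_le[of n c \<phi>] by simp
  with True show ?thesis by simp
next
  case False
  let ?E = "measure_pmf.expectation (random_clause k n)"
  note int = integrable_random_clause[OF assms(2)]
  define Z0 where "Z0 = real (Z n \<phi>)"
  define e where "e = 1 / (2::real) ^ k"
  define a where "a = (1 - e) * Z0"
  \<comment> \<open>This \<theta> maximises
    \<open>\<theta> * (e\<^sup>2 - \<theta> * real k)\<close>, the gain from the correlation minus
    the second-order cost.\<close>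
  define \<theta> where "\<theta> = e\<^sup>2 / (2 * real k)"
  define H where "H = real (card L) * (real k / (2 * real n))"
  let ?h = "\<lambda>c. \<Sum>l\<in>L. of_bool (l \<in> set c) :: real"
  let ?z = "\<lambda>c. real (Z n (c # \<phi>))"
  have Z0: "Z0 > 0" using False by (simp add: Z0_def)
  have "(2::real) ^ 1 \<le> 2 ^ k" using assms(1) by (intro power_increasing) auto
  hence e: "0 < e" "e < 1" by (auto simp: e_def field_simps)
  have a: "0 < a" "a \<le> Z0" using e Z0 by (auto simp: a_def)
  have H: "0 \<le> H" by (simp add: H_def)
  have Eh: "?E ?h = H"
    using int by (simp add: H_def prob_contains_literal[OF assms(1,2) L(2)])
  have Ez: "?E ?z = a"
    using expectation_Z_Cons[OF assms(2)] by (simp add: a_def e_def Z0_def)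
  \<comment> \<open>Here \<open>H * a\<close> is the product of the two means, so the bias yields a
    covariance of at least \<open>H * e\<^sup>2 * Z0\<close>.\<close>
  have Ehz: "?E (\<lambda>c. ?h c * ?z c) \<ge> H * (a + e\<^sup>2 * Z0)"
  proof -
    have "?E (\<lambda>c. ?h c * ?z c) = (\<Sum>l\<in>L. ?E (\<lambda>c. of_bool (l \<in> set c) * ?z c))"
      using int by (simp add: sum_distrib_right)
    also have "\<dots> \<ge> (\<Sum>l\<in>L. real k / (2 * real n) * (a + e\<^sup>2 * Z0))"
    proof (rule sum_mono)
      fix l assume l: "l \<in> L"
      have "2 * real (card {\<sigma> \<in> solutions n \<phi>. \<sigma> (fst l) \<noteq> snd l}) * e \<le> (Z0 * (1 - e)) * e"
        using bias[OF l] e by (intro mult_right_mono) (auto simp: Z0_def e_def)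
      hence "a + e\<^sup>2 * Z0 \<le> Z0 - 2 * real (card {\<sigma> \<in> solutions n \<phi>. \<sigma> (fst l) \<noteq> snd l}) / 2 ^ k"
        by (simp add: a_def e_def algebra_simps power2_eq_square)
      thus "real k / (2 * real n) * (a + e\<^sup>2 * Z0) \<le> ?E (\<lambda>c. of_bool (l \<in> set c) * ?z c)"
        by (subst expectation_Z_Cons_literal[OF assms(1,2) L(2)[OF l]])
           (intro mult_left_mono, auto simp: Z0_def)
    qed
    finally show ?thesis by (simp add: H_def)
  qed
  have "?E (\<lambda>c. sqrt (?z c)) * sqrt a = ?E (\<lambda>c. sqrt (?z c) * sqrt a)"
    by simp
  also have "\<dots> \<le> ?E (\<lambda>c. (a + \<theta> * a * ?h c + ?z c - \<theta> * (?h c * ?z c) + \<theta>\<^sup>2 * real k * Z0 * ?h c) / 2)"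
  proof (rule integral_mono_AE[OF int int], unfold AE_measure_pmf_iff, intro ballI sqrt_tilted_bound)
    fix c assume c: "c \<in> set_pmf (random_clause k n)"
    show "?h c \<le> real k"
      by (rule card_literals_le[OF set_random_clause[OF assms(2) c] L(1)])
    show "?z c \<le> Z0" using Z_Cons_le[of n c \<phi>] by (simp add: Z0_def)
  qed (use a in \<open>auto simp: \<theta>_def sum_nonneg\<close>)
  also have "\<dots> = (a + \<theta> * a * ?E ?h + ?E ?z - \<theta> * ?E (\<lambda>c. ?h c * ?z c) + \<theta>\<^sup>2 * real k * Z0 * ?E ?h) / 2"
    using int by simp
  also have "\<dots> \<le> (a + \<theta> * a * H + a - \<theta> * (H * (a + e\<^sup>2 * Z0)) + \<theta>\<^sup>2 * real k * Z0 * H) / 2"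
  proof -
    have "\<theta> * (H * (a + e\<^sup>2 * Z0)) \<le> \<theta> * ?E (\<lambda>c. ?h c * ?z c)"
      by (rule mult_left_mono[OF Ehz]) (simp add: \<theta>_def)
    thus ?thesis unfolding Eh Ez by simp
  qed
  also have "\<dots> = a - Z0 * (\<theta> * H) * (e\<^sup>2 - \<theta> * real k) / 2"
    by (simp add: field_simps power2_eq_square)
  also have "\<theta> * real k = e\<^sup>2 / 2"
    using assms(1) by (simp add: \<theta>_def)
  also have "\<theta> * H = e\<^sup>2 * real (card L) / (4 * real n)"
    using assms(1) by (simp add: \<theta>_def H_def)
  also have "a - Z0 * (e\<^sup>2 * real (card L) / (4 * real n)) * (e\<^sup>2 - e\<^sup>2 / 2) / 2 =
      a - Z0 * (e ^ 4 * real (card L) / (16 * real n))"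
    by (simp add: power4_eq_xxxx power2_eq_square)
  \<comment> \<open>Replacing \<open>Z0\<close> by the smaller \<open>a\<close> lets a factor
    \<open>sqrt a\<close> be cancelled on both sides. The power \<open>e ^ 4\<close> is the origin
    of \<open>16 ^ k\<close> in the statement.\<close>
  also have "\<dots> \<le> a - a * (e ^ 4 * real (card L) / (16 * real n))"
    using a by (intro diff_left_mono mult_right_mono) auto
  also have "\<dots> = sqrt a * (1 - e ^ 4 * real (card L) / (16 * real n)) * sqrt a"
    using a by (simp add: algebra_simps)
  finally have "?E (\<lambda>c. sqrt (?z c)) \<le> sqrt a * (1 - e ^ 4 * real (card L) / (16 * real n))"
    using a by (simp only: mult_le_cancel_right) simp
  moreover have "e ^ 4 = 1 / 16 ^ k"
    by (simp add: e_def power_divide power_mult[symmetric] mult.commute[of k]) (simp add: power_mult)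
  ultimately show ?thesis
    by (simp add: a_def e_def Z0_def mult.commute mult.left_commute)
qed

subsection \<open>Exposing the clauses one at a time\<close>

lemma set_P_unif:
  "set_pmf (P_unif k n m) = {\<phi> \<in> lists (set_pmf (random_clause k n)). length \<phi> = m}"
  by (simp add: P_unif_def set_replicate_pmf)

lemma P_unif_clauses:
  assumes "k \<le> n" "\<phi> \<in> set_pmf (P_unif k n m)" "c \<in> set \<phi>"
  shows "set c \<in> clauses k n"
  using assms set_random_clause by (auto simp: set_P_unif)

lemma finite_set_P_unif:
  assumes "k \<le> n"
  shows "finite (set_pmf (P_unif k n m))"
  using finite_lists_length_eq[OF finite_set_random_clause[OF assms], of m]
  by (rule rev_finite_subset) (auto simp: set_P_unif)

lemma integrable_P_unif:
  fixes f :: "literal list list \<Rightarrow> real"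
  assumes "k \<le> n"
  shows "integrable (measure_pmf (P_unif k n m)) f"
  by (rule integrable_measure_pmf_finite[OF finite_set_P_unif[OF assms]])

text \<open>Commuting the independent draws puts the newest clause innermost, so the inner
  expectation is conditional on the earlier clauses \<phi>.\<close>

lemma expectation_P_unif_Suc:
  fixes f :: "literal list list \<Rightarrow> real"
  assumes "k \<le> n"
  shows "measure_pmf.expectation (P_unif k n (Suc m)) f =
    measure_pmf.expectation (P_unif k n m)
      (\<lambda>\<phi>. measure_pmf.expectation (random_clause k n) (\<lambda>c. f (c # \<phi>)))"
proof -
  have "P_unif k n (Suc m) = bind_pmf (P_unif k n m) (\<lambda>\<phi>. map_pmf (\<lambda>c. c # \<phi>) (random_clause k n))"
    unfolding P_unif_def replicate_pmf.simps map_pmf_def by (rule bind_commute_pmf)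
  moreover have "measure_pmf.expectation (P_unif k n m \<bind> (\<lambda>\<phi>. map_pmf (\<lambda>c. c # \<phi>) (random_clause k n))) f =
    (\<Sum>\<phi>\<in>set_pmf (P_unif k n m). pmf (P_unif k n m) \<phi> *\<^sub>R
       measure_pmf.expectation (map_pmf (\<lambda>c. c # \<phi>) (random_clause k n)) f)"
    using finite_set_random_clause[OF assms] finite_set_P_unif[OF assms]
    by (intro pmf_expectation_bind) auto
  ultimately show ?thesis
    by (simp add: integral_measure_pmf[OF finite_set_P_unif[OF assms]])
qed

lemma Z_Nil: "Z n [] = 2 ^ n"
  by (simp add: Z_def satisfies_def card_PiE)

lemma expectation_Z:
  assumes "k \<le> n"
  shows "measure_pmf.expectation (P_unif k n m) (\<lambda>\<phi>. real (Z n \<phi>)) = 2 ^ n * (1 - 1 / 2 ^ k) ^ m"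
proof (induction m)
  case 0
  show ?case by (simp add: P_unif_def Z_Nil)
next
  case (Suc m)
  thus ?case
    by (simp add: expectation_P_unif_Suc[OF assms] expectation_Z_Cons[OF assms])
qed

section \<open>The expected number of overlaps\<close>

text \<open>Union bound over the \<open>2 * k\<close> literals on the variables of \<open>d\<close>,
  each of which occurs with probability \<open>k / (2 * n)\<close>.\<close>

lemma prob_meets_le:
  assumes "0 < k" "k \<le> n" "set d \<in> clauses k n"
  shows "measure_pmf.expectation (random_clause k n) (\<lambda>c. of_bool (meets c d)) \<le> (real k)\<^sup>2 / real n"
proof -
  note int = integrable_random_clause[OF assms(2)]
  let ?V = "fst ` set d"
  have "measure_pmf.expectation (random_clause k n) (\<lambda>c. of_bool (meets c d)) \<le>
      measure_pmf.expectation (random_clause k n)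
        (\<lambda>c. \<Sum>l\<in>?V \<times> UNIV. of_bool (l \<in> set c) :: real)"
  proof (rule integral_mono[OF int int])
    fix c
    show "of_bool (meets c d) \<le> (\<Sum>l\<in>?V \<times> UNIV. of_bool (l \<in> set c) :: real)"
    proof (cases "meets c d")
      case True
      then obtain l where l: "l \<in> set c" "fst l \<in> ?V" 
        unfolding meets_def by blast
      hence "l \<in> ?V \<times> UNIV" by (simp add: mem_Times_iff)
      hence "(\<Sum>l\<in>?V \<times> UNIV. of_bool (l \<in> set c)) \<ge> (of_bool (l \<in> set c) :: real)"
        by (intro member_le_sum) auto
      thus ?thesis using l by simp
    qed (simp add: sum_nonneg)
  qed
  also have "\<dots> = (\<Sum>l\<in>?V \<times> (UNIV :: bool set). real k / (2 * real n))"
  proof -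
    have "fst l \<in> {1..n}" if "l \<in> ?V \<times> (UNIV :: bool set)" for l
      using that assms(3) by (auto simp: clauses_def)
    thus ?thesis
      using int by (simp add: prob_contains_literal[OF assms(1,2)] del: sum_of_bool_eq sum_constant)
  qed
  also have "\<dots> = (real k)\<^sup>2 / real n"
    using assms(3) by (simp add: clauses_def card_image card_cartesian_product power2_eq_square)
  finally show ?thesis .
qed

text \<open>A clause added to \<open>m\<close> others creates at most
  \<open>m * k\<^sup>2 / n\<close> new overlaps on average, and
  \<open>m\<^sup>2 + m \<le> (m + 1)\<^sup>2\<close>.\<close>

lemma expectation_overlaps_le:
  assumes "0 < k" "k \<le> n"
  shows "measure_pmf.expectation (P_unif k n m) (\<lambda>\<phi>. real (overlaps \<phi>)) \<le> (real m)\<^sup>2 * (real k)\<^sup>2 / real n"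
proof (induction m)
  case 0
  show ?case by (simp add: P_unif_def)
next
  case (Suc m)
  note int = integrable_random_clause[OF assms(2)] integrable_P_unif[OF assms(2)]
  have len: "real (length (filter (meets c) \<phi>)) = (\<Sum>d\<leftarrow>\<phi>. of_bool (meets c d))" for c \<phi>
    by (induction \<phi>) auto
  have swap: "measure_pmf.expectation (random_clause k n) (\<lambda>c. \<Sum>d\<leftarrow>\<phi>. of_bool (meets c d) :: real) =
      (\<Sum>d\<leftarrow>\<phi>. measure_pmf.expectation (random_clause k n) (\<lambda>c. of_bool (meets c d)))" for \<phi>
    using int by (induction \<phi>) auto
  have "measure_pmf.expectation (P_unif k n (Suc m)) (\<lambda>\<phi>. real (overlaps \<phi>)) =
      measure_pmf.expectation (P_unif k n m) (\<lambda>\<phi>. real (overlaps \<phi>) +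
        (\<Sum>d\<leftarrow>\<phi>. measure_pmf.expectation (random_clause k n) (\<lambda>c. of_bool (meets c d))))"
    using int by (simp add: expectation_P_unif_Suc[OF assms(2)] len swap)
  also have "\<dots> \<le> measure_pmf.expectation (P_unif k n m) (\<lambda>\<phi>. real (overlaps \<phi>) + real m * ((real k)\<^sup>2 / real n))"
  proof (rule integral_mono_AE[OF int(2) int(2)], unfold AE_measure_pmf_iff, intro ballI add_left_mono)
    fix \<phi> assume \<phi>: "\<phi> \<in> set_pmf (P_unif k n m)"
    have "(\<Sum>d\<leftarrow>\<phi>. measure_pmf.expectation (random_clause k n) (\<lambda>c. of_bool (meets c d))) \<le>
        (\<Sum>d\<leftarrow>\<phi>. (real k)\<^sup>2 / real n)"
      by (intro sum_list_mono prob_meets_le[OF assms] P_unif_clauses[OF assms(2) \<phi>])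
    also have "\<dots> = real m * ((real k)\<^sup>2 / real n)"
      using \<phi> by (simp add: set_P_unif sum_list_triv)
    finally show "(\<Sum>d\<leftarrow>\<phi>. measure_pmf.expectation (random_clause k n) (\<lambda>c. of_bool (meets c d))) \<le>
        real m * ((real k)\<^sup>2 / real n)" .
  qed
  also have "\<dots> \<le> (real m)\<^sup>2 * (real k)\<^sup>2 / real n + real m * ((real k)\<^sup>2 / real n)"
    using int Suc.IH by simp
  also have "\<dots> = ((real m)\<^sup>2 + real m) * ((real k)\<^sup>2 / real n)"
    by (simp add: distrib_right add_divide_distrib)
  also have "\<dots> \<le> (real (Suc m))\<^sup>2 * ((real k)\<^sup>2 / real n)"
    by (intro mult_right_mono) (auto simp: power2_eq_square algebra_simps)
  also have "\<dots> = (real (Suc m))\<^sup>2 * (real k)\<^sup>2 / real n"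
    by simp
  finally show ?case .
qed

section \<open>Decay of the expected square root\<close>

text \<open>One biased literal is taken from each isolated clause, namely its head. Distinct
  isolated clauses share no variable, so these literals are distinct.\<close>

lemma expectation_sqrt_Z_Cons_isolated_le:
  assumes "0 < k" "k \<le> n" and \<phi>: "\<And>c. c \<in> set \<phi> \<Longrightarrow> set c \<in> clauses k n"
  shows "measure_pmf.expectation (random_clause k n) (\<lambda>c. sqrt (real (Z n (c # \<phi>)))) \<le>
    sqrt (1 - 1 / 2 ^ k) * sqrt (real (Z n \<phi>)) *
      (1 - (real (length \<phi>) - 2 * real (overlaps \<phi>)) / (16 * 16 ^ k * real n))"
proof -
  have ne: "c \<noteq> []" if "c \<in> set \<phi>" for c
    using \<phi>[OF that] assms(1) by (auto simp: clauses_def)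
  let ?L = "hd ` isolated \<phi>"
  have sub: "isolated \<phi> \<subseteq> set \<phi>" by (auto simp: isolated_def)
  have "inj_on hd (isolated \<phi>)"
  proof (rule inj_onI, rule ccontr)
    fix c d assume cd: "c \<in> isolated \<phi>" "d \<in> isolated \<phi>" "hd c = hd d" "c \<noteq> d"
    hence "hd c \<in> set c" "hd c \<in> set d" using sub ne by (metis hd_in_set subsetD)+
    hence "meets c d" by (auto simp: meets_def)
    thus False using cd by (auto simp: isolated_def)
  qed
  hence "card ?L = card (isolated \<phi>)" by (rule card_image)
  moreover have "length \<phi> \<le> card (isolated \<phi>) + 2 * overlaps \<phi>"
    using ne by (intro length_le_card_isolated) blast
  ultimately have L: "real (length \<phi>) - 2 * real (overlaps \<phi>) \<le> real (card ?L)"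
    by linarith
  have "measure_pmf.expectation (random_clause k n) (\<lambda>c. sqrt (real (Z n (c # \<phi>)))) \<le>
      sqrt ((1 - 1 / 2 ^ k) * real (Z n \<phi>)) * (1 - card ?L / (16 * 16 ^ k * real n))"
  proof (rule expectation_sqrt_Z_Cons_le[OF assms(1,2)])
    fix l assume "l \<in> ?L"
    then obtain c where c: "c \<in> isolated \<phi>" "l = hd c" by blast
    hence "set c \<in> clauses k n" "l \<in> set c" using sub ne \<phi> by auto
    thus "fst l \<in> {1..n}"
      and "2 * real (card {\<sigma> \<in> solutions n \<phi>. \<sigma> (fst l) \<noteq> snd l}) \<le> real (Z n \<phi>) * (1 - 1 / 2 ^ k)"
      using isolated_literal_bias[OF c(1)] by (auto simp: clauses_def)
  qed simp
  also have "\<dots> \<le> sqrt ((1 - 1 / 2 ^ k) * real (Z n \<phi>)) *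
      (1 - (real (length \<phi>) - 2 * real (overlaps \<phi>)) / (16 * 16 ^ k * real n))"
    using L by (intro mult_left_mono diff_left_mono divide_right_mono) auto
  finally show ?thesis by (simp add: real_sqrt_mult)
qed

text \<open>
  Overlaps only accumulate, so the event of few overlaps may be imposed at every step. Each clause
  added once \<open>s\<close> clauses are present then sees at least \<open>g\<close> isolated clauses, which costs a factor \<open>1 - g / (16 * 16 ^ k * n)\<close>.
\<close>

lemma expectation_sqrt_Z_le:
  fixes B g :: real
  assumes "0 < k" "k \<le> n" and g: "0 \<le> g" "g \<le> real s - 2 * B"
  shows "measure_pmf.expectation (P_unif k n m) (\<lambda>\<phi>. of_bool (real (overlaps \<phi>) \<le> B) * sqrt (real (Z n \<phi>))) \<le>
    sqrt (2 ^ n * (1 - 1 / 2 ^ k) ^ m) * exp (- (g / (16 * 16 ^ k * real n)) * real (m - s))"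
proof (induction m)
  case 0
  show ?case by (simp add: P_unif_def Z_Nil)
next
  case (Suc m)
  note int = integrable_random_clause[OF assms(2)] integrable_P_unif[OF assms(2)]
  let ?q = "1 - 1 / (2::real) ^ k"
  let ?W = "16 * 16 ^ k * real n"
  let ?G = "\<lambda>\<phi>. of_bool (real (overlaps \<phi>) \<le> B) * sqrt (real (Z n \<phi>))"
  \<comment> \<open>The extra factor of a single step. No gain is claimed before \<open>s\<close>
    clauses are present, matching the truncated difference \<open>m - s\<close>.\<close>
  define r where "r = (if s \<le> m then exp (- (g / ?W)) else 1)"
  have r: "exp (- (g / ?W) * real (Suc m - s)) = r * exp (- (g / ?W) * real (m - s))"
  proof (cases "s \<le> m")
    case True
    have "- c * real (Suc m - s) = - c + - c * real (m - s)" for c :: real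
      using True by (simp add: Suc_diff_le algebra_simps)
    thus ?thesis using True by (simp only: r_def if_True exp_add)
  qed (simp add: r_def)
  have q: "?q \<ge> 0" by simp
  have "measure_pmf.expectation (P_unif k n (Suc m)) ?G \<le>
      measure_pmf.expectation (P_unif k n m) (\<lambda>\<phi>. sqrt ?q * r * ?G \<phi>)"
    unfolding expectation_P_unif_Suc[OF assms(2)]
  proof (rule integral_mono_AE[OF int(2) int(2)], unfold AE_measure_pmf_iff, intro ballI)
    fix \<phi> assume \<phi>: "\<phi> \<in> set_pmf (P_unif k n m)"
    have len: "length \<phi> = m" using \<phi> by (simp add: set_P_unif)
    show "measure_pmf.expectation (random_clause k n) (\<lambda>c. ?G (c # \<phi>)) \<le> sqrt ?q * r * ?G \<phi>"
    proof (cases "real (overlaps \<phi>) \<le> B")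
      case True
      have "measure_pmf.expectation (random_clause k n) (\<lambda>c. ?G (c # \<phi>)) \<le>
          measure_pmf.expectation (random_clause k n) (\<lambda>c. sqrt (real (Z n (c # \<phi>))))"
        by (intro integral_mono int) auto
      also have "\<dots> \<le> sqrt ?q * sqrt (real (Z n \<phi>)) * r"
      proof (cases "s \<le> m")
        case sm: True
        have "measure_pmf.expectation (random_clause k n) (\<lambda>c. sqrt (real (Z n (c # \<phi>)))) \<le>
            sqrt ?q * sqrt (real (Z n \<phi>)) * (1 - (real (length \<phi>) - 2 * real (overlaps \<phi>)) / ?W)"
          by (intro expectation_sqrt_Z_Cons_isolated_le[OF assms(1,2)] P_unif_clauses[OF assms(2) \<phi>])
        also have "\<dots> \<le> sqrt ?q * sqrt (real (Z n \<phi>)) * (1 - g / ?W)"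
          using g True sm q by (intro mult_left_mono diff_left_mono divide_right_mono) (auto simp: len)
        also have "1 - g / ?W \<le> r"
          using exp_ge_add_one_self[of "- (g / ?W)"] sm by (simp add: r_def)
        finally show ?thesis using q by (simp add: mult_left_mono)
      next
        case False
        \<comment> \<open>With the empty set of biased literals the bound is just concavity of the
          square root.\<close>
        have "measure_pmf.expectation (random_clause k n) (\<lambda>c. sqrt (real (Z n (c # \<phi>)))) \<le>
            sqrt (?q * real (Z n \<phi>)) * (1 - real (card ({} :: literal set)) / ?W)"
          by (intro expectation_sqrt_Z_Cons_le[OF assms(1,2)]) auto
        thus ?thesis using False by (simp add: r_def real_sqrt_mult)
      qed
      finally show ?thesis using True by (simp add: mult_ac)
    next
      case False
      \<comment> \<open>Overlaps never decrease, so both sides vanish.\<close>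
      hence "\<not> real (overlaps (c # \<phi>)) \<le> B" for c by simp
      thus ?thesis using False by simp
    qed
  qed
  also have "\<dots> = sqrt ?q * r * measure_pmf.expectation (P_unif k n m) ?G"
    by simp
  also have "\<dots> \<le> sqrt ?q * r * (sqrt (2 ^ n * ?q ^ m) * exp (- (g / ?W) * real (m - s)))"
    using q by (intro mult_left_mono Suc.IH) (auto simp: r_def)
  also have "\<dots> = sqrt (2 ^ n * ?q ^ Suc m) * exp (- (g / ?W) * real (Suc m - s))"
    unfolding r by (simp add: real_sqrt_mult)
  finally show ?case .
qed

section \<open>Markov's inequality and the choice of constants\<close>

text \<open>Markov's inequality is applied twice: to the number of overlaps, for the event that it
  exceeds \<open>m / 8\<close>, and to the square root of \<open>Z\<close> on the complementary
  event.\<close>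

lemma prob_Z_ge_le:
  assumes "0 < k" "k \<le> n" "2 \<le> m"
  shows "measure_pmf.prob (P_unif k n m)
      {\<phi>. real (Z n \<phi>) \<ge> exp (- a) * measure_pmf.expectation (P_unif k n m) (\<lambda>\<psi>. real (Z n \<psi>))} \<le>
    8 * real m * (real k)\<^sup>2 / real n + exp (a / 2 - (real m)\<^sup>2 / (256 * 16 ^ k * real n))"
proof -
  note int = integrable_P_unif[OF assms(2)]
  let ?E = "measure_pmf.expectation (P_unif k n m)"
  let ?G = "\<lambda>\<phi>. of_bool (real (overlaps \<phi>) \<le> real m / 8) * sqrt (real (Z n \<phi>))"
  define M where "M = ?E (\<lambda>\<psi>. real (Z n \<psi>))"
  define S where "S = {\<phi>. real (Z n \<phi>) \<ge> exp (- a) * M}"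
  have M: "M = 2 ^ n * (1 - 1 / 2 ^ k) ^ m"
    unfolding M_def by (rule expectation_Z[OF assms(2)])
  have "(2::real) ^ 1 \<le> 2 ^ k" using assms(1) by (intro power_increasing) auto
  hence "(0::real) < 1 - 1 / 2 ^ k" by (simp add: field_simps)
  hence M0: "M > 0" by (simp add: M)
  have "measure_pmf.prob (P_unif k n m) S = ?E (indicator S)"
    by simp
  \<comment> \<open>Both applications at once: on \<open>S\<close> at least one of the two
    nonnegative summands is at least \<open>1\<close>.\<close>
  also have "\<dots> \<le> ?E (\<lambda>\<phi>. 8 / real m * real (overlaps \<phi>) + exp (a / 2) / sqrt M * ?G \<phi>)"
  proof (intro integral_mono int)
    fix \<phi>
    have nonneg: "8 / real m * real (overlaps \<phi>) \<ge> 0" "exp (a / 2) / sqrt M * ?G \<phi> \<ge> 0"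
      using M0 by auto
    show "indicator S \<phi> \<le> 8 / real m * real (overlaps \<phi>) + exp (a / 2) / sqrt M * ?G \<phi>"
    proof (cases "\<phi> \<in> S")
      case True
      show ?thesis
      proof (cases "real (overlaps \<phi>) \<le> real m / 8")
        case few: True
        have "(exp (a / 2))\<^sup>2 * exp (- a) = 1"
          by (simp add: exp_double[symmetric] exp_minus)
        hence "M = (exp (a / 2))\<^sup>2 * (exp (- a) * M)"
          by (simp only: mult.assoc[symmetric] mult_1)
        also have "\<dots> \<le> (exp (a / 2))\<^sup>2 * real (Z n \<phi>)"
          using True by (intro mult_left_mono) (auto simp: S_def)
        finally have "sqrt M \<le> exp (a / 2) * sqrt (real (Z n \<phi>))"
          using real_sqrt_le_mono by (fastforce simp: real_sqrt_mult)
        hence "1 \<le> exp (a / 2) / sqrt M * ?G \<phi>"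
          using M0 few by (simp add: field_simps)
        thus ?thesis using nonneg(1) indicator_simps(1)[OF True, where ?'b = real] by linarith
      next
        case False
        hence "1 \<le> 8 / real m * real (overlaps \<phi>)"
          using assms(3) by (simp add: field_simps)
        thus ?thesis using nonneg True by simp
      qed
    next
      case False
      thus ?thesis using nonneg by simp
    qed
  qed
  also have "\<dots> = 8 / real m * ?E (\<lambda>\<phi>. real (overlaps \<phi>)) + exp (a / 2) / sqrt M * ?E ?G"
    using int by simp
  also have "\<dots> \<le> 8 / real m * ((real m)\<^sup>2 * (real k)\<^sup>2 / real n) +
      exp (a / 2) / sqrt M * (sqrt M * exp (- ((real m)\<^sup>2 / (256 * 16 ^ k * real n))))"
  proof (intro add_mono mult_left_mono)
    show "?E (\<lambda>\<phi>. real (overlaps \<phi>)) \<le> (real m)\<^sup>2 * (real k)\<^sup>2 / real n"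
      by (rule expectation_overlaps_le[OF assms(1,2)])
    \<comment> \<open>Half of \<open>m\<close>, rounded up: then
      \<open>s - 2 * (m / 8) \<ge> m / 4\<close> isolated clauses are guaranteed, and
      \<open>m \<ge> 2\<close> leaves at least \<open>m / 4\<close> further steps. The two factors
      \<open>m / 4\<close> turn \<open>16\<close> into \<open>256\<close>.\<close>
    define s where "s = (m + 1) div 2"
    have s: "real m / 2 \<le> real s" "real m / 4 \<le> real (m - s)"
      using assms(3) by (auto simp: s_def)
    have "?E ?G \<le> sqrt M * exp (- (real m / 4 / (16 * 16 ^ k * real n)) * real (m - s))"
      unfolding M using s(1) by (intro expectation_sqrt_Z_le[OF assms(1,2)]) auto
    also have "\<dots> \<le> sqrt M * exp (- (real m / 4 / (16 * 16 ^ k * real n)) * (real m / 4))"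
    proof (intro mult_left_mono)
      show "exp (- (real m / 4 / (16 * 16 ^ k * real n)) * real (m - s)) \<le>
          exp (- (real m / 4 / (16 * 16 ^ k * real n)) * (real m / 4))"
        unfolding exp_le_cancel_iff by (rule mult_left_mono_neg[OF s(2)]) simp
    qed (use M0 in simp)
    also have "- (real m / 4 / (16 * 16 ^ k * real n)) * (real m / 4) = - ((real m)\<^sup>2 / (256 * 16 ^ k * real n))"
      by (simp add: power2_eq_square)
    finally show "?E ?G \<le> sqrt M * exp (- ((real m)\<^sup>2 / (256 * 16 ^ k * real n)))" .
  qed (use M0 in auto)
  also have "\<dots> = 8 * real m * (real k)\<^sup>2 / real n + exp (a / 2 - (real m)\<^sup>2 / (256 * 16 ^ k * real n))"
    using M0 assms(3) exp_add[of "a / 2" "- ((real m)\<^sup>2 / (256 * 16 ^ k * real n))"]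
    by (simp add: power2_eq_square)
  finally show ?thesis by (simp add: S_def M_def)
qed

theorem lemma2p2:
  shows "\<exists>C0::real. C0 > 0 \<and>
    (\<forall>k::nat. k \<ge> 2 \<longrightarrow>
      (\<exists>\<gamma>::real. \<gamma> > 0 \<and>
        (\<exists>C1::real. \<forall>C::real. C \<ge> C1 \<longrightarrow>
          (\<exists>N::nat. \<forall>n::nat. n \<ge> N \<longrightarrow>
            (\<forall>m::nat. m > 0 \<longrightarrow> real m = C * sqrt (real n) \<longrightarrow>
              measure_pmf.prob (P_unif k n m)
                {\<phi>. real (Z n \<phi>) < exp (- (\<gamma> * C ^ 2 / C0)) *
                      measure_pmf.expectation (P_unif k n m) (\<lambda>\<psi>. real (Z n \<psi>))}
              \<ge> 1 - C0 / C ^ 2)))))"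
proof (rule exI[of _ 2], intro conjI allI impI)
  fix k :: nat assume k: "k \<ge> 2"
  \<comment> \<open>With \<open>real m = C * sqrt (real n)\<close>, the decay exponent of
    \<open>prob_Z_ge_le\<close> equals \<open>\<kappa> * C\<^sup>2\<close>.\<close>
  define \<kappa> where "\<kappa> = 1 / (256 * 16 ^ k :: real)"
  have \<kappa>: "\<kappa> > 0" by (simp add: \<kappa>_def)
  show "\<exists>\<gamma>::real. \<gamma> > 0 \<and>
        (\<exists>C1::real. \<forall>C::real. C \<ge> C1 \<longrightarrow>
          (\<exists>N::nat. \<forall>n::nat. n \<ge> N \<longrightarrow>
            (\<forall>m::nat. m > 0 \<longrightarrow> real m = C * sqrt (real n) \<longrightarrow>
              measure_pmf.prob (P_unif k n m)
                {\<phi>. real (Z n \<phi>) < exp (- (\<gamma> * C ^ 2 / 2)) *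
                      measure_pmf.expectation (P_unif k n m) (\<lambda>\<psi>. real (Z n \<psi>))}
              \<ge> 1 - 2 / C ^ 2)))"
  proof (rule exI[of _ "2 * \<kappa>"], rule conjI, use \<kappa> in simp, rule exI[of _ "4 / \<kappa> + 2"], intro allI impI)
    fix C :: real assume C: "C \<ge> 4 / \<kappa> + 2"
    have "4 / \<kappa> > 0" using \<kappa> by simp
    hence C2: "C \<ge> 2" and C4: "4 / \<kappa> \<le> C" using C by linarith+
    \<comment> \<open>The threshold \<open>4 / \<kappa>\<close> for \<open>C\<close> makes
      \<open>C\<close> at most \<open>exp (\<kappa> * C\<^sup>2 / 4)\<close>; squaring then bounds
      the exponential error term by \<open>1 / C\<^sup>2\<close>.\<close>
    have "4 \<le> \<kappa> * C"
      using C4 \<kappa> by (simp add: divide_le_eq mult.commute)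
    hence "4 * C \<le> \<kappa> * C * C"
      using C2 by (intro mult_right_mono) auto
    hence "C \<le> 1 + \<kappa> * C\<^sup>2 / 4"
      by (simp add: power2_eq_square algebra_simps)
    also have "\<dots> \<le> exp (\<kappa> * C\<^sup>2 / 4)"
      by (rule exp_ge_add_one_self)
    finally have "C\<^sup>2 \<le> (exp (\<kappa> * C\<^sup>2 / 4))\<^sup>2"
      using C2 by (intro power_mono) auto
    also have "\<dots> = exp (\<kappa> * C\<^sup>2 / 2)"
      by (simp add: exp_double[symmetric])
    finally have tail: "exp (- (\<kappa> * C\<^sup>2 / 2)) \<le> 1 / C\<^sup>2"
      using C2 by (simp add: exp_minus field_simps)
    \<comment> \<open>The overlap term equals \<open>8 * C * k\<^sup>2 / sqrt n\<close>, which is at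
      most \<open>1 / C\<^sup>2\<close> once \<open>sqrt n\<close> reaches \<open>R\<close>.\<close>
    define R where "R = 8 * C ^ 3 * (real k)\<^sup>2"
    have R: "R \<ge> 0" using C2 by (simp add: R_def)
    show "\<exists>N::nat. \<forall>n::nat. n \<ge> N \<longrightarrow>
            (\<forall>m::nat. m > 0 \<longrightarrow> real m = C * sqrt (real n) \<longrightarrow>
              measure_pmf.prob (P_unif k n m)
                {\<phi>. real (Z n \<phi>) < exp (- (2 * \<kappa> * C ^ 2 / 2)) *
                      measure_pmf.expectation (P_unif k n m) (\<lambda>\<psi>. real (Z n \<psi>))}
              \<ge> 1 - 2 / C ^ 2)"
    proof (intro exI[of _ "k + nat \<lceil>R\<^sup>2\<rceil>"] allI impI)
      fix n m :: nat assume n: "n \<ge> k + nat \<lceil>R\<^sup>2\<rceil>" and m: "m > 0" "real m = C * sqrt (real n)"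
      have kn: "k \<le> n" "0 < k" "0 < n" using n k by auto
      have "R\<^sup>2 \<le> real n" using n by linarith
      hence sqn: "R \<le> sqrt (real n)" using R by (simp add: real_le_rsqrt)
      have "1 \<le> sqrt (real n)" using kn by simp
      hence "2 * 1 \<le> C * sqrt (real n)" using C2 by (intro mult_mono) auto
      hence m2: "2 \<le> m" using m by linarith
      have m2n: "(real m)\<^sup>2 / real n = C\<^sup>2"
        using kn by (simp add: m(2) power_mult_distrib)
      let ?M = "measure_pmf.expectation (P_unif k n m) (\<lambda>\<psi>. real (Z n \<psi>))"
      \<comment> \<open>The choice \<gamma> = \<open>2 * \<kappa>\<close> makes the deviation
        \<open>a = \<kappa> * C\<^sup>2\<close>. Since \<open>a\<close> enters halved, it uses up
        only half of the decay exponent.\<close>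
      let ?S = "{\<phi>. real (Z n \<phi>) \<ge> exp (- (\<kappa> * C\<^sup>2)) * ?M}"
      have "measure_pmf.prob (P_unif k n m) ?S \<le>
          8 * real m * (real k)\<^sup>2 / real n + exp (\<kappa> * C\<^sup>2 / 2 - (real m)\<^sup>2 / (256 * 16 ^ k * real n))"
        by (rule prob_Z_ge_le[OF kn(2,1) m2])
      also have "(real m)\<^sup>2 / (256 * 16 ^ k * real n) = \<kappa> * ((real m)\<^sup>2 / real n)"
        by (simp add: \<kappa>_def)
      also have "8 * real m * (real k)\<^sup>2 / real n + exp (\<kappa> * C\<^sup>2 / 2 - \<kappa> * ((real m)\<^sup>2 / real n)) =
          8 * real m * (real k)\<^sup>2 / real n + exp (- (\<kappa> * C\<^sup>2 / 2))"
        by (simp add: m2n)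
      also have "8 * real m * (real k)\<^sup>2 / real n \<le> 1 / C\<^sup>2"
      proof -
        have "8 * real m * (real k)\<^sup>2 * C\<^sup>2 = R * sqrt (real n)"
          by (simp add: m(2) R_def power2_eq_square power3_eq_cube)
        also have "\<dots> \<le> sqrt (real n) * sqrt (real n)"
          using sqn by (intro mult_right_mono) auto
        finally have "8 * real m * (real k)\<^sup>2 * C\<^sup>2 \<le> real n" by simp
        thus ?thesis using kn C2 by (simp add: field_simps)
      qed
      \<comment> \<open>Each of the two error terms contributes \<open>1 / C\<^sup>2\<close>, whence
        the value \<open>2\<close> for \<open>C0\<close>.\<close>
      also have "1 / C\<^sup>2 + exp (- (\<kappa> * C\<^sup>2 / 2)) \<le> 2 / C\<^sup>2"
        using tail by simp
      finally have "measure_pmf.prob (P_unif k n m) ?S \<le> 2 / C\<^sup>2" by simp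
      moreover have "measure_pmf.prob (P_unif k n m) (- ?S) = 1 - measure_pmf.prob (P_unif k n m) ?S"
        using measure_pmf.prob_compl[of ?S "P_unif k n m"] by (simp add: Compl_eq_Diff_UNIV)
      moreover have "- ?S = {\<phi>. real (Z n \<phi>) < exp (- (2 * \<kappa> * C ^ 2 / 2)) * ?M}"
        by auto
      ultimately show "measure_pmf.prob (P_unif k n m)
          {\<phi>. real (Z n \<phi>) < exp (- (2 * \<kappa> * C ^ 2 / 2)) * ?M} \<ge> 1 - 2 / C ^ 2"
        by simp
    qed
  qed
qed simp

end
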